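(* Let $n\ge 1$ (and $n\geq 2$ for DCT-1). For each of the 16 discrete cosine and sine transforms let $C\in\{T,U,V,W\}$, the polynomial $p$ and the scaling function $f$ be as follows, where $f$ is a function of $\theta\in[0,\pi]$ with $\cos\theta=x$: $C=T$, $f=1$: DCT-1 has $p=T_n-T_{n-2}=2(x^2-1)U_{n-2}$; DCT-3 has $p=T_n$; DCT-5 has $p=T_n-T_{n-1}=(x-1)W_{n-1}$; DCT-7 has $p=T_n+T_{n-1}=(x+1)V_{n-1}$. $C=U$, $f=\sin\theta$: DST-3 has $p=U_n-U_{n-2}=2T_n$; DST-1 has $p=U_n$; DST-7 has $p=U_n-U_{n-1}=V_n$; DST-5 has $p=U_n+U_{n-1}=W_n$. $C=V$, $f=\cos\frac{\theta}{2}$: DCT-6 has $p=V_n-V_{n-2}=2(x-1)W_{n-1}$; DCT-8 has $p=V_n$; DCT-2 has $p=V_n-V_{n-1}=2(x-1)U_{n-1}$; DCT-4 has $p=V_n+V_{n-1}=2T_n$. $C=W$, $f=\sin\frac{\theta}{2}$: DST-8 has $p=W_n-W_{n-2}=2(x+1)V_{n-1}$; DST-6 has $p=W_n$; DST-4 has $p=W_n-W_{n-1}=2T_n$; DST-2 has $p=W_n+W_{n-1}=2(x+1)U_{n-1}$. Then in each of the 16 cases $p$ has $n$ distinct zeros, and, with $\alpha=(\alpha_0,\dots,\alpha_{n-1})$ the zeros of $p$ ordered decreasingly and $b=(C_0,\dots,C_{n-1})$, $$\mathrm{DTT}_n=\operatorname{diag}_{0\le k<n}\bigl(f(\alpha_k)\bigr)\cdot\mathcal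 P_{b,\alpha},\qquad \mathcal P_{b,\alpha}=[C_\ell(\alpha_k)]_{0\le k,\ell<n},$$ where $\mathrm{DTT}_n$ is the respective transform and all $f(\alpha_k)\ne 0$. Consequently $\mathrm{DTT}_n$ is a Fourier transform for the regular module $\mathbb C[x]/p(x)$ with basis $b$; namely, it is the matrix of the decomposition $\mathbb C[x]/p\to\bigoplus_{0\le k<n}\mathbb C[x]/(x-\alpha_k)$, $s\mapsto (s(\alpha_k))_k$, with respect to the basis $b$ and the bases $(1/f(\alpha_k))$ of $\mathbb C[x]/(x-\alpha_k)$.
   Context: Chebyshev polynomials: $T,U,V,W$ are the sequences $(C_n)_{n\in\mathbb Z}$ of polynomials satisfying $C_{n+1}=2xC_n-C_{n-1}$ with $C_0=1$ and $T_1=x$, $U_1=2x$, $V_1=2x-1$, $W_1=2x+1$. The (unscaled) transforms are the $n\times n$ matrices with the following entry at row $k$, column $\ell$, $0\le k,\ell<n$: DCT-1: $\cos\frac{k\ell\pi}{n-1}$; DCT-2: $\cos\frac{k(\ell+1/2)\pi}{n}$; DCT-3: $\cos\frac{(k+1/2)\ell\pi}{n}$; DCT-4: $\cos\frac{(k+1/2)(\ell+1/2)\pi}{n}$; DCT-5: $\cos\frac{k\ell\pi}{n-1/2}$; DCT-6: $\cos\frac{k(\ell+1/2)\pi}{n-1/2}$; DCT-7: $\cos\frac{(k+1/2)\ell\pi}{n-1/2}$; DCT-8: $\cos\frac{(k+1/2)(\ell+1/2)\pi}{n+1/2}$; DST-1: $\sin\frac{(k+1)(\ell+1)\pi}{n+1}$;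 DST-2: $\sin\frac{(k+1)(\ell+1/2)\pi}{n}$; DST-3: $\sin\frac{(k+1/2)(\ell+1)\pi}{n}$; DST-4: $\sin\frac{(k+1/2)(\ell+1/2)\pi}{n}$; DST-5: $\sin\frac{(k+1)(\ell+1)\pi}{n+1/2}$; DST-6: $\sin\frac{(k+1)(\ell+1/2)\pi}{n+1/2}$; DST-7: $\sin\frac{(k+1/2)(\ell+1)\pi}{n+1/2}$; DST-8: $\sin\frac{(k+1/2)(\ell+1/2)\pi}{n-1/2}$. $f(\alpha_k)$ means the value of $f$ at $\theta=\arccos\alpha_k\in[0,\pi]$. A Fourier transform for $\mathbb C[x]/p$ ($p$ with distinct zeros $\alpha_k$) with basis $b$ is any matrix representing the Chinese-remainder isomorphism $s\mapsto(s(\alpha_k))_k$ onto $\bigoplus_k\mathbb C[x]/(x-\alpha_k)$ with respect to $b$ and some choice of one-element bases $(a_k)$, $a_k\in\mathbb C\setminus\{0\}$, of the summands. *)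

theory Defs
  imports
    "HOL-Algebra.Chinese_Remainder"
    "HOL-Algebra.Embedded_Algebras"
    "HOL-Algebra.Algebraic_Closure_Type"
    "Jordan_Normal_Form.Matrix"
    "HOL-Computational_Algebra.Polynomial"
begin

section \<open>Chebyshev polynomials\<close>

fun cheb_nat :: "complex poly \<Rightarrow> nat \<Rightarrow> complex poly" where
  "cheb_nat q 0 = 1"
| "cheb_nat q (Suc 0) = q"
| "cheb_nat q (Suc (Suc n)) = [:0, 2:] * cheb_nat q (Suc n) - cheb_nat q n"

text \<open>
  The two-sided sequence with \<open>C 0 = 1\<close>, \<open>C 1 = q\<close> and \<open>C (m + 1) = 2 x C m - C (m - 1)\<close>. The
  recurrence is invariant under \<open>m \<mapsto> -m\<close>, so the part with negative indices is the same
  recursion started from \<open>C (-1) = 2 x - q\<close>; see \<open>cheb_rec\<close> and \<open>cheb_unique\<close>.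
\<close>

definition cheb :: "complex poly \<Rightarrow> int \<Rightarrow> complex poly" where
  "cheb q m = (if 0 \<le> m then cheb_nat q (nat m) else cheb_nat ([:0, 2:] - q) (nat (- m)))"

lemma cheb_0 [simp]: "cheb q 0 = 1"
  by (simp add: cheb_def)

lemma cheb_1 [simp]: "cheb q 1 = q"
  by (simp add: cheb_def)

lemma cheb_rec: "cheb q (m + 1) = [:0, 2:] * cheb q m - cheb q (m - 1)"
proof -
  consider "m \<ge> 1" | "m = 0" | "m = -1" | "m \<le> -2" by linarith
  then show ?thesis
  proof cases
    case 1
    define k where "k = nat (m - 1)"
    have "m = int k + 1" using 1 by (simp add: k_def)
    then show ?thesis by (simp add: cheb_def nat_add_distrib)
  next
    case 2
    then show ?thesis by (simp add: cheb_def)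
  next
    case 3
    have "nat 2 = Suc (Suc 0)" by simp
    with 3 show ?thesis by (simp add: cheb_def del: nat_numeral)
  next
    case 4
    define k where "k = nat (- m - 2)"
    have m: "m = - int k - 2" using 4 by (simp add: k_def)
    have "nat (- (m + 1)) = Suc k" "nat (- m) = Suc (Suc k)"
      "nat (- (m - 1)) = Suc (Suc (Suc k))"
      using m by auto
    then show ?thesis using 4 by (simp add: cheb_def)
  qed
qed

lemma cheb_unique:
  assumes "c 0 = 1" "c 1 = q" and rec: "\<And>m::int. c (m + 1) = [:0, 2:] * c m - c (m - 1)"
  shows "c m = cheb q m"
proof -
  have "c (int k) = cheb q (int k) \<and> c (int k + 1) = cheb q (int k + 1)" for k
  proof (induction k)
    case (Suc k)
    then show ?case
      using rec[of "int k + 1"] cheb_rec[of q "int k + 1"]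
      by (simp add: add.commute del: mult_pCons_left)
  qed (use assms in simp)
  moreover have "c (- int k) = cheb q (- int k) \<and> c (- int k + 1) = cheb q (- int k + 1)" for k
  proof (induction k)
    case (Suc k)
    have "c (- int k - 1) = [:0, 2:] * c (- int k) - c (- int k + 1)"
      "cheb q (- int k - 1) = [:0, 2:] * cheb q (- int k) - cheb q (- int k + 1)"
      using rec[of "- int k"] cheb_rec[of q "- int k"] by (simp_all del: mult_pCons_left)
    moreover have "- int (Suc k) = - int k - 1" "- int (Suc k) + 1 = - int k" by simp_all
    ultimately show ?case using Suc by presburger
  qed (use assms in simp)
  ultimately show ?thesis
    by (cases m rule: int_cases2) auto
qed

abbreviation chebT :: "int \<Rightarrow> complex poly" where "chebT \<equiv> cheb [:0, 1:]"
abbreviation chebU :: "int \<Rightarrow> complex poly" where "chebU \<equiv> cheb [:0, 2:]"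
abbreviation chebV :: "int \<Rightarrow> complex poly" where "chebV \<equiv> cheb [:-1, 2:]"
abbreviation chebW :: "int \<Rightarrow> complex poly" where "chebW \<equiv> cheb [:1, 2:]"


section \<open>The sixteen transforms\<close>

datatype dtt =
    DCT1 | DCT2 | DCT3 | DCT4 | DCT5 | DCT6 | DCT7 | DCT8
  | DST1 | DST2 | DST3 | DST4 | DST5 | DST6 | DST7 | DST8

fun dtt_entry :: "dtt \<Rightarrow> real \<Rightarrow> real \<Rightarrow> real \<Rightarrow> real" where
  "dtt_entry DCT1 n k l = cos (k * l * pi / (n - 1))"
| "dtt_entry DCT2 n k l = cos (k * (l + 1/2) * pi / n)"
| "dtt_entry DCT3 n k l = cos ((k + 1/2) * l * pi / n)"
| "dtt_entry DCT4 n k l = cos ((k + 1/2) * (l + 1/2) * pi / n)"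
| "dtt_entry DCT5 n k l = cos (k * l * pi / (n - 1/2))"
| "dtt_entry DCT6 n k l = cos (k * (l + 1/2) * pi / (n - 1/2))"
| "dtt_entry DCT7 n k l = cos ((k + 1/2) * l * pi / (n - 1/2))"
| "dtt_entry DCT8 n k l = cos ((k + 1/2) * (l + 1/2) * pi / (n + 1/2))"
| "dtt_entry DST1 n k l = sin ((k + 1) * (l + 1) * pi / (n + 1))"
| "dtt_entry DST2 n k l = sin ((k + 1) * (l + 1/2) * pi / n)"
| "dtt_entry DST3 n k l = sin ((k + 1/2) * (l + 1) * pi / n)"
| "dtt_entry DST4 n k l = sin ((k + 1/2) * (l + 1/2) * pi / n)"
| "dtt_entry DST5 n k l = sin ((k + 1) * (l + 1) * pi / (n + 1/2))"
| "dtt_entry DST6 n k l = sin ((k + 1) * (l + 1/2) * pi / (n + 1/2))"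
| "dtt_entry DST7 n k l = sin ((k + 1/2) * (l + 1) * pi / (n + 1/2))"
| "dtt_entry DST8 n k l = sin ((k + 1/2) * (l + 1/2) * pi / (n - 1/2))"

definition dtt_mat :: "dtt \<Rightarrow> nat \<Rightarrow> complex mat" where
  "dtt_mat t n = mat n n (\<lambda>(k, l). complex_of_real (dtt_entry t (real n) (real k) (real l)))"

fun dtt_cheb :: "dtt \<Rightarrow> int \<Rightarrow> complex poly" where
  "dtt_cheb DCT1 = chebT" | "dtt_cheb DCT3 = chebT" | "dtt_cheb DCT5 = chebT" | "dtt_cheb DCT7 = chebT"
| "dtt_cheb DST3 = chebU" | "dtt_cheb DST1 = chebU" | "dtt_cheb DST7 = chebU" | "dtt_cheb DST5 = chebU"
| "dtt_cheb DCT6 = chebV" | "dtt_cheb DCT8 = chebV" | "dtt_cheb DCT2 = chebV" | "dtt_cheb DCT4 = chebV"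
| "dtt_cheb DST8 = chebW" | "dtt_cheb DST6 = chebW" | "dtt_cheb DST4 = chebW" | "dtt_cheb DST2 = chebW"

text \<open>The scaling function, as a function of the angle \<open>\<theta> \<in> [0, \<pi>]\<close> with \<open>cos \<theta> = x\<close>.\<close>

fun dtt_scale :: "dtt \<Rightarrow> real \<Rightarrow> real" where
  "dtt_scale DCT1 \<theta> = 1" | "dtt_scale DCT3 \<theta> = 1"
| "dtt_scale DCT5 \<theta> = 1" | "dtt_scale DCT7 \<theta> = 1"
| "dtt_scale DST3 \<theta> = sin \<theta>" | "dtt_scale DST1 \<theta> = sin \<theta>"
| "dtt_scale DST7 \<theta> = sin \<theta>" | "dtt_scale DST5 \<theta> = sin \<theta>"
| "dtt_scale DCT6 \<theta> = cos (\<theta> / 2)" | "dtt_scale DCT8 \<theta> = cos (\<theta> / 2)"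
| "dtt_scale DCT2 \<theta> = cos (\<theta> / 2)" | "dtt_scale DCT4 \<theta> = cos (\<theta> / 2)"
| "dtt_scale DST8 \<theta> = sin (\<theta> / 2)" | "dtt_scale DST6 \<theta> = sin (\<theta> / 2)"
| "dtt_scale DST4 \<theta> = sin (\<theta> / 2)" | "dtt_scale DST2 \<theta> = sin (\<theta> / 2)"

fun dtt_poly :: "dtt \<Rightarrow> int \<Rightarrow> complex poly" where
  "dtt_poly DCT1 n = chebT n - chebT (n - 2)"
| "dtt_poly DCT3 n = chebT n"
| "dtt_poly DCT5 n = chebT n - chebT (n - 1)"
| "dtt_poly DCT7 n = chebT n + chebT (n - 1)"
| "dtt_poly DST3 n = chebU n - chebU (n - 2)"
| "dtt_poly DST1 n = chebU n"
| "dtt_poly DST7 n = chebU n - chebU (n - 1)"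
| "dtt_poly DST5 n = chebU n + chebU (n - 1)"
| "dtt_poly DCT6 n = chebV n - chebV (n - 2)"
| "dtt_poly DCT8 n = chebV n"
| "dtt_poly DCT2 n = chebV n - chebV (n - 1)"
| "dtt_poly DCT4 n = chebV n + chebV (n - 1)"
| "dtt_poly DST8 n = chebW n - chebW (n - 2)"
| "dtt_poly DST6 n = chebW n"
| "dtt_poly DST4 n = chebW n - chebW (n - 1)"
| "dtt_poly DST2 n = chebW n + chebW (n - 1)"

text \<open>
  The second form of the polynomial. For \<open>DCT3\<close>, \<open>DST1\<close>, \<open>DCT8\<close> and \<open>DST6\<close> there is only
  one form, which is repeated here.
\<close>

fun dtt_poly_alt :: "dtt \<Rightarrow> int \<Rightarrow> complex poly" where
  "dtt_poly_alt DCT1 n = 2 * ([:0, 1:]\<^sup>2 - 1) * chebU (n - 2)"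
| "dtt_poly_alt DCT3 n = chebT n"
| "dtt_poly_alt DCT5 n = ([:0, 1:] - 1) * chebW (n - 1)"
| "dtt_poly_alt DCT7 n = ([:0, 1:] + 1) * chebV (n - 1)"
| "dtt_poly_alt DST3 n = 2 * chebT n"
| "dtt_poly_alt DST1 n = chebU n"
| "dtt_poly_alt DST7 n = chebV n"
| "dtt_poly_alt DST5 n = chebW n"
| "dtt_poly_alt DCT6 n = 2 * ([:0, 1:] - 1) * chebW (n - 1)"
| "dtt_poly_alt DCT8 n = chebV n"
| "dtt_poly_alt DCT2 n = 2 * ([:0, 1:] - 1) * chebU (n - 1)"
| "dtt_poly_alt DCT4 n = 2 * chebT n"
| "dtt_poly_alt DST8 n = 2 * ([:0, 1:] + 1) * chebV (n - 1)"
| "dtt_poly_alt DST6 n = chebW n"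
| "dtt_poly_alt DST4 n = 2 * chebT n"
| "dtt_poly_alt DST2 n = 2 * ([:0, 1:] + 1) * chebU (n - 1)"

text \<open>
  The real zeros of a nonzero polynomial in decreasing order. That all complex zeros are real is
  not built in.
\<close>

definition decreasing_zeros :: "complex poly \<Rightarrow> real list" where
  "decreasing_zeros p = rev (sorted_list_of_set {x. poly p (complex_of_real x) = 0})"

definition polynomial_transform :: "complex poly list \<Rightarrow> complex list \<Rightarrow> complex mat" where
  "polynomial_transform bs zs = mat (length zs) (length bs) (\<lambda>(k, l). poly (bs ! l) (zs ! k))"


section \<open>Fourier transforms for \<open>\<complex>[x]/p\<close>\<close>

subsection \<open>Bases and matrices of linear maps\<close>

text \<open>
  A \<open>\<complex>\<close>-algebra is given by a ring \<open>R\<close> with an embedding \<open>\<iota>\<close> of the scalars; \<open>Span\<close>,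
  \<open>independent\<close> and \<open>combine\<close> (linear combinations) are relative to the subfield \<open>range \<iota>\<close>.
\<close>

definition is_basis :: "'a ring \<Rightarrow> (complex \<Rightarrow> 'a) \<Rightarrow> 'a list \<Rightarrow> bool" where
  "is_basis R \<iota> us \<longleftrightarrow>
     ring.independent R (range \<iota>) us \<and> ring.Span R (range \<iota>) us = carrier R"

text \<open>Column \<open>l\<close> of \<open>M\<close> holds the coordinates of the image of the \<open>l\<close>-th basis vector.\<close>

definition represents ::
  "'a ring \<Rightarrow> (complex \<Rightarrow> 'a) \<Rightarrow> 'a list \<Rightarrow> 'b ring \<Rightarrow> (complex \<Rightarrow> 'b) \<Rightarrow> 'b list \<Rightarrow>
   complex mat \<Rightarrow> ('a \<Rightarrow> 'b) \<Rightarrow> bool"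
where
  "represents R \<iota> us S \<kappa> vs M \<phi> \<longleftrightarrow>
     is_basis R \<iota> us \<and> is_basis S \<kappa> vs \<and> M \<in> carrier_mat (length vs) (length us) \<and>
     (\<forall>l < length us. \<phi> (us ! l) = ring.combine S (map (\<lambda>k. \<kappa> (M $$ (k, l))) [0..<length vs]) vs)"

subsection \<open>Quotients and direct sums of quotients\<close>

definition poly_quot :: "complex poly \<Rightarrow> complex poly set ring" where
  "poly_quot p = ring_of_type_algebra Quot (PIdl\<^bsub>ring_of_type_algebra\<^esub> p)"

definition residue :: "complex poly \<Rightarrow> complex poly \<Rightarrow> complex poly set" where
  "residue p s = (PIdl\<^bsub>ring_of_type_algebra\<^esub> p) +>\<^bsub>ring_of_type_algebra\<^esub> s"

abbreviation const_residue :: "complex poly \<Rightarrow> complex \<Rightarrow> complex poly set" where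
  "const_residue p c \<equiv> residue p [:c:]"

text \<open>The direct sum of the \<open>\<complex>[x]/(x - z)\<close>, for \<open>z\<close> in the list \<open>zs\<close>, with its diagonal scalars.\<close>

definition sum_quot :: "complex list \<Rightarrow> complex poly set list ring" where
  "sum_quot zs = RDirProd_list (map (\<lambda>z. poly_quot [:-z, 1:]) zs)"

definition sum_scalar :: "complex list \<Rightarrow> complex \<Rightarrow> complex poly set list" where
  "sum_scalar zs c = map (\<lambda>z. const_residue [:-z, 1:] c) zs"

text \<open>The basis of the direct sum composed of the one-element bases \<open>(as ! k)\<close> of the summands.\<close>

definition sum_basis :: "complex list \<Rightarrow> complex list \<Rightarrow> complex poly set list list" where
  "sum_basis zs as =
     map (\<lambda>k. map (\<lambda>j. const_residue [:-(zs ! j), 1:] (if j = k then as ! j else 0))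
       [0..<length zs]) [0..<length zs]"

subsection \<open>The decomposition and its matrices\<close>

text \<open>
  An isomorphism of algebras is in particular one of \<open>\<complex>[x]\<close>-modules, as \<open>h\<close> acts
  on the regular module and on its summands by multiplication with the residue of \<open>h\<close>.
\<close>

definition is_crt_iso ::
  "complex poly \<Rightarrow> complex list \<Rightarrow> (complex poly set \<Rightarrow> complex poly set list) \<Rightarrow> bool"
where
  "is_crt_iso p zs \<phi> \<longleftrightarrow>
     \<phi> \<in> ring_iso (poly_quot p) (sum_quot zs) \<and>
     (\<forall>s. \<phi> (residue p s) = map (\<lambda>z. const_residue [:-z, 1:] (poly s z)) zs)"

definition is_decomposition_matrix ::
  "complex poly \<Rightarrow> complex list \<Rightarrow> complex poly list \<Rightarrow> complex list \<Rightarrow> complex mat \<Rightarrow> bool"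
where
  "is_decomposition_matrix p zs bs as M \<longleftrightarrow>
     length as = length zs \<and>
     (\<forall>k < length zs. is_basis (poly_quot [:-(zs ! k), 1:]) (const_residue [:-(zs ! k), 1:])
        [const_residue [:-(zs ! k), 1:] (as ! k)]) \<and>
     (\<exists>\<phi>. is_crt_iso p zs \<phi> \<and>
        represents (poly_quot p) (const_residue p) (map (residue p) bs)
          (sum_quot zs) (sum_scalar zs) (sum_basis zs as) M \<phi>)"

definition is_fourier_transform ::
  "complex poly \<Rightarrow> complex list \<Rightarrow> complex poly list \<Rightarrow> complex mat \<Rightarrow> bool"
where
  "is_fourier_transform p zs bs M \<longleftrightarrow>
     distinct zs \<and> set zs = {z. poly p z = 0} \<and>
     (\<exists>as. 0 \<notin> set as \<and> is_decomposition_matrix p zs bs as M)"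

end

theory Submission
  imports Defs
begin

text \<open>
  At \<open>x = cos \<theta>\<close> the recurrence of the polynomials \<open>C\<^sub>m\<close> is the addition theorem, so \<open>f(\<theta>) C\<^sub>m(cos \<theta>)\<close>
  is a cosine or sine of a multiple of \<open>\<theta>\<close>. The polynomial \<open>p\<close> has the form \<open>C\<^sub>n + e C\<^sub>n\<^sub>-\<^sub>j\<close>, and a
  sum-to-product formula makes it vanish at the cosines of \<open>n\<close> angles \<open>(k + s)\<pi>/d\<close> in \<open>[0, \<pi>]\<close>;
  since \<open>deg p = n\<close>, these are all zeros. Substituting the angles into the trigonometric form of
  \<open>f(\<theta>) C\<^sub>l(cos \<theta>)\<close> gives the entries of the transform.

  For the algebraic part, the basis of the direct sum with entry \<open>1/f(\<alpha>\<^sub>k)\<close> in the \<open>k\<close>-th summand is the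
  image of interpolation polynomials. So all bases involved are images of polynomials under
  quotient maps from \<open>\<complex>[x]\<close>, and linear combinations can be computed there.
\<close>

section \<open>Chebyshev polynomials and the zeros of the sixteen polynomials\<close>

text \<open>The right side obeys the recurrence and, since \<open>chebU (-1) = 0\<close>, starts
  with 1 and \<open>q\<close>; so \<open>cheb_unique\<close> applies.\<close>

lemma cheb_eq_chebU: "cheb q m = chebU m + (q - [:0, 2:]) * chebU (m - 1)"
proof (rule cheb_unique[symmetric])
  fix m :: int
  show "chebU (m + 1) + (q - [:0, 2:]) * chebU (m + 1 - 1) =
    [:0, 2:] * (chebU m + (q - [:0, 2:]) * chebU (m - 1)) -
    (chebU (m - 1) + (q - [:0, 2:]) * chebU (m - 1 - 1))"
    using cheb_rec[of "[:0, 2:]" m] cheb_rec[of "[:0, 2:]" "m - 1"]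
    by (simp add: ring_distribs mult.left_commute del: mult_pCons_left mult_pCons_right)
qed (simp_all add: cheb_def)

text \<open>Written in terms of U, every case is linear in the neighbours \<open>u 0\<close> to
  \<open>u 3\<close>. Two instances of the recurrence eliminate \<open>u 0\<close> and
  \<open>u 3\<close>, and ring arithmetic remains.\<close>

lemma dtt_poly_eq_alt: "dtt_poly t m = dtt_poly_alt t m"
proof -
  define x :: "complex poly" where "x = [:0, 1:]"
  define u where "u k = chebU (m - k)" for k
  have lin: "[:0, 2:] = 2 * x" "[:0, 1:] - [:0, 2:] = - x"
    "[:-1, 2:] - [:0, 2:] = (-1 :: complex poly)" "[:1, 2:] - [:0, 2:] = (1 :: complex poly)"
    by (simp_all add: x_def numeral_poly one_pCons)
  have "chebU (j + 1) = 2 * x * chebU j - chebU (j - 1)" for j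
    unfolding lin(1)[symmetric] by (rule cheb_rec)
  from this[of "m - 1"] this[of "m - 2"]
  have u: "u 0 = 2 * x * u 1 - u 2" "u 3 = 2 * x * u 2 - u 1"
    by (simp_all add: u_def diff_diff_eq)
  have T: "chebT (m - k) = u k - x * u (k + 1)" for k
    using cheb_eq_chebU[of "[:0, 1:]" "m - k"] unfolding lin(2) by (simp add: u_def algebra_simps)
  have V: "chebV (m - k) = u k - u (k + 1)" for k
    using cheb_eq_chebU[of "[:-1, 2:]" "m - k"] unfolding lin(3) by (simp add: u_def algebra_simps)
  have W: "chebW (m - k) = u k + u (k + 1)" for k
    using cheb_eq_chebU[of "[:1, 2:]" "m - k"] unfolding lin(4) by (simp add: u_def algebra_simps)
  have U: "chebU (m - k) = u k" for k by (simp add: u_def)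
  \<comment> \<open>The equations for \<open>m - k\<close> do not match the unshifted index
    \<open>m\<close>; these instances do.\<close>
  note at_0 = T[of 0, simplified] V[of 0, simplified] W[of 0, simplified] U[of 0, simplified]
  show ?thesis
    by (cases t; simp only: dtt_poly.simps dtt_poly_alt.simps T U V W at_0)
      (simp_all add: x_def[symmetric] u algebra_simps power2_eq_square)
qed

lemma degree_cheb_nat: "degree q = 1 \<Longrightarrow> degree (cheb_nat q k) = k"
proof (induction q k rule: cheb_nat.induct)
  case (3 q k)
  then have "cheb_nat q (Suc k) \<noteq> 0" by auto
  then have "degree ([:0, 2:] * cheb_nat q (Suc k)) = Suc (Suc k)"
    using 3 by (subst degree_mult_eq) auto
  moreover have "degree (- cheb_nat q k) < Suc (Suc k)" using 3 by simp
  ultimately show ?case by (metis cheb_nat.simps(3) degree_add_eq_left diff_conv_add_uminus)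
qed auto

lemma degree_cheb: "degree q = 1 \<Longrightarrow> degree (cheb q (int k)) = k"
  by (simp add: cheb_def degree_cheb_nat)

lemma cheb_neq_0:
  assumes "degree q = 1"
  shows "cheb q (int k) \<noteq> 0"
  using degree_cheb[OF assms, of k] by (cases k) auto

lemma dtt_cheb_eq: "\<exists>q. dtt_cheb t = cheb q \<and> degree q = 1"
  by (cases t) auto

section \<open>Uniform data for the sixteen cases and their trigonometric form\<close>

definition dtt_wave :: "dtt \<Rightarrow> real \<Rightarrow> real \<Rightarrow> real" where
  "dtt_wave t m \<theta> =
    (if t \<in> {DCT1, DCT3, DCT5, DCT7} then cos (m * \<theta>)
     else if t \<in> {DST1, DST3, DST5, DST7} then sin ((m + 1) * \<theta>)
     else if t \<in> {DCT2, DCT4, DCT6, DCT8} then cos ((m + 1/2) * \<theta>)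
     else sin ((m + 1/2) * \<theta>))"

text \<open>\<open>dtt_tail_coeff\<close> and \<open>dtt_tail_shift\<close> are e and j in p = C_n +
  e C_(n-j). One-term polynomials get e = 0 and the default j = 1.\<close>

definition dtt_tail_coeff :: "dtt \<Rightarrow> real" where
  "dtt_tail_coeff t =
    (if t \<in> {DCT3, DST1, DCT8, DST6} then 0 else if t \<in> {DCT7, DST5, DCT4, DST2} then 1 else -1)"

definition dtt_tail_shift :: "dtt \<Rightarrow> int" where
  "dtt_tail_shift t = (if t \<in> {DCT1, DST3, DCT6, DST8} then 2 else 1)"

text \<open>The zeros will be at the angles (k+s)\<pi>/d with s = \<open>dtt_shift t\<close> and d =
  \<open>dtt_period t n\<close>. Here d is the frequency in the wave of C_n, averaged with that of
  C_(n-j) if e is nonzero. The product form then contains cos(d\<theta>), giving s = 1/2, or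
  sin(d\<theta>), giving s = 0, or s = 1 if f vanishes at the angle 0.\<close>

definition dtt_shift :: "dtt \<Rightarrow> real" where
  "dtt_shift t =
    (if t \<in> {DCT1, DCT2, DCT5, DCT6} then 0 else if t \<in> {DST1, DST2, DST5, DST6} then 1 else 1/2)"

definition dtt_period :: "dtt \<Rightarrow> real \<Rightarrow> real" where
  "dtt_period t n =
    (if t = DCT1 then n - 1 else if t = DST1 then n + 1
     else if t \<in> {DCT5, DCT6, DCT7, DST8} then n - 1/2
     else if t \<in> {DCT8, DST5, DST6, DST7} then n + 1/2 else n)"

definition dtt_angle :: "dtt \<Rightarrow> nat \<Rightarrow> nat \<Rightarrow> real" where
  "dtt_angle t n k = (real k + dtt_shift t) * pi / dtt_period t (real n)"

lemma dtt_poly_eq_tail: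
  "dtt_poly t m =
    dtt_cheb t m + smult (of_real (dtt_tail_coeff t)) (dtt_cheb t (m - dtt_tail_shift t))"
  by (cases t) (simp_all add: dtt_tail_coeff_def dtt_tail_shift_def)

lemma degree_dtt_poly:
  assumes "n \<ge> 1" "t = DCT1 \<longrightarrow> n \<ge> 2"
  shows "degree (dtt_poly t (int n)) = n"
proof -
  have "degree (dtt_cheb t (int n - dtt_tail_shift t)) < n"
  proof (cases "n = 1 \<and> dtt_tail_shift t = 2")
    \<comment> \<open>The tail has index -1, outside the scope of \<open>degree_cheb\<close>. U, V,
      W are the constants 0, 1, -1 there; T_(-1) = x would have degree n, but \<open>DCT1\<close>
      with n = 1 is excluded.\<close>
    case True
    then show ?thesis
      using assms(2) by (cases t) (simp_all add: dtt_tail_shift_def cheb_def)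
  next
    case False
    then have "int n - dtt_tail_shift t = int (n - nat (dtt_tail_shift t))" "dtt_tail_shift t > 0"
      using assms(1) by (auto simp: dtt_tail_shift_def split: if_splits)
    moreover obtain q where "dtt_cheb t = cheb q" "degree q = 1" using dtt_cheb_eq by blast
    ultimately have "degree (dtt_cheb t (int n - dtt_tail_shift t)) = n - nat (dtt_tail_shift t)"
      by (simp only: degree_cheb)
    also have "\<dots> < n" using \<open>dtt_tail_shift t > 0\<close> assms(1) by simp
    finally show ?thesis .
  qed
  moreover have "degree (dtt_cheb t (int n)) = n"
    using dtt_cheb_eq[of t] degree_cheb by auto
  ultimately show ?thesis
    unfolding dtt_poly_eq_tail
    by (subst degree_add_eq_left) (auto intro: le_less_trans[OF degree_smult_le])
qed

lemma dtt_wave_rec: "dtt_wave t (m + 1) \<theta> = 2 * cos \<theta> * dtt_wave t m \<theta> - dtt_wave t (m - 1) \<theta>"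
proof -
  have "cos (a + \<theta>) = 2 * cos \<theta> * cos a - cos (a - \<theta>)" "sin (a + \<theta>) = 2 * cos \<theta> * sin a - sin (a - \<theta>)" for a
    by (simp_all add: cos_add cos_diff sin_add sin_diff)
  from this[of "m * \<theta>"] this[of "(m + 1) * \<theta>"] this[of "(m + 1/2) * \<theta>"]
  show ?thesis by (simp add: dtt_wave_def algebra_simps)
qed

text \<open>Both sides satisfy the same three-term recurrence, so agreement at -1 and 0 suffices.
  Starting at -1 covers the tail C_(n-2) for n = 1.\<close>

lemma dtt_wave_eq_cheb:
  assumes "m \<ge> -1"
  shows "complex_of_real (dtt_wave t (of_int m) \<theta>) =
    of_real (dtt_scale t \<theta>) * poly (dtt_cheb t m) (of_real (cos \<theta>))"
proof -
  obtain q where q: "dtt_cheb t = cheb q" using dtt_cheb_eq by blast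
  let ?P = "\<lambda>m. complex_of_real (dtt_wave t (of_int m) \<theta>) =
    of_real (dtt_scale t \<theta>) * poly (dtt_cheb t m) (of_real (cos \<theta>))"
  have "?P (int k - 1) \<and> ?P (int k)" for k
  proof (induction k)
    case 0
    show ?case
      by (cases t) (simp_all add: dtt_wave_def cheb_def algebra_simps)
  next
    case (Suc k)
    have wave: "dtt_wave t (of_int (int k + 1)) \<theta> =
        2 * cos \<theta> * dtt_wave t (of_int (int k)) \<theta> - dtt_wave t (of_int (int k - 1)) \<theta>"
      using dtt_wave_rec[of t "int k" \<theta>] by simp
    have "?P (int k + 1)"
      unfolding wave of_real_diff of_real_mult Suc.IH[THEN conjunct1] Suc.IH[THEN conjunct2]
      unfolding q cheb_rec[of q "int k"] by (simp add: algebra_simps)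
    then show ?case using Suc by (simp add: add.commute)
  qed
  from this[of "nat (m + 1)"] show ?thesis using assms by simp
qed

text \<open>The argument of every entry splits into the row angle (k+s)\<pi>/d and a column
  frequency l, l + 1 or l + 1/2.\<close>

lemma dtt_entry_eq_wave: "dtt_entry t (real n) (real k) l = dtt_wave t l (dtt_angle t n k)"
  by (cases t) (simp_all add: dtt_wave_def dtt_angle_def dtt_shift_def dtt_period_def mult_ac)

section \<open>Angles of the zeros\<close>

lemma dtt_angle_less:
  assumes "n \<ge> 1" "t = DCT1 \<longrightarrow> n \<ge> 2" "j < k"
  shows "dtt_angle t n j < dtt_angle t n k"
  unfolding dtt_angle_def using assms
  by (cases t) (auto simp: dtt_period_def intro!: divide_strict_right_mono mult_strict_right_mono)

text \<open>Since 0 \<le> k+s \<le> d, the angles stay in [0, \<pi>]. An endpoint is avoided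
  wherever f vanishes there: s > 0 for U and W excludes 0, and k+s < d for U and V excludes
  \<pi>.\<close>

lemma dtt_angle_bounds:
  assumes "n \<ge> 1" "t = DCT1 \<longrightarrow> n \<ge> 2" "k < n"
  shows "0 \<le> dtt_angle t n k" "dtt_angle t n k \<le> pi"
    and "dtt_scale t (dtt_angle t n k) \<noteq> 0"
proof -
  have period: "dtt_period t n > 0"
    using assms(1,2) by (cases t) (auto simp: dtt_period_def)
  have le: "real k + dtt_shift t \<le> dtt_period t n"
    using assms(3) by (cases t) (auto simp: dtt_period_def dtt_shift_def)
  show ge: "0 \<le> dtt_angle t n k"
    using period by (simp add: dtt_angle_def dtt_shift_def)
  have eq: "dtt_angle t n k = (real k + dtt_shift t) / dtt_period t n * pi"
    by (simp add: dtt_angle_def)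
  show le_pi: "dtt_angle t n k \<le> pi"
    unfolding eq using period le by (intro mult_left_le_one_le) (auto simp: dtt_shift_def)
  have less_pi: "dtt_angle t n k < pi" if "real k + dtt_shift t < dtt_period t n"
    using that period mult_strict_right_mono[of "(real k + dtt_shift t) / dtt_period t n" 1 pi]
    by (simp add: eq)
  have gt: "dtt_angle t n k > 0" if "dtt_shift t > 0"
    using that period by (simp add: dtt_angle_def)
  consider "t \<in> {DCT1, DCT3, DCT5, DCT7}" | "t \<in> {DST1, DST3, DST5, DST7}"
    | "t \<in> {DCT2, DCT4, DCT6, DCT8}" | "t \<in> {DST2, DST4, DST6, DST8}"
    by (cases t) auto
  then show "dtt_scale t (dtt_angle t n k) \<noteq> 0"
  proof cases
    case 2
    then have "sin (dtt_angle t n k) > 0"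
      using assms(3) by (intro sin_gt_zero gt less_pi) (auto simp: dtt_shift_def dtt_period_def)
    with 2 show ?thesis by auto
  next
    case 3
    then have "cos (dtt_angle t n k / 2) > 0"
      using ge less_pi assms(3) by (intro cos_gt_zero_pi) (auto simp: dtt_shift_def dtt_period_def)
    with 3 show ?thesis by auto
  next
    case 4
    then have "sin (dtt_angle t n k / 2) > 0"
      using gt le_pi by (intro sin_gt_zero) (auto simp: dtt_shift_def)
    with 4 show ?thesis by auto
  qed auto
qed

text \<open>Sum-to-product in disguise: with a = d\<theta> = (k+s)\<pi> and n\<theta> = a +
  c\<theta>, the addition theorems leave a multiple of cos a or of sin a, whichever the choice of s
  makes vanish.\<close>

lemma dtt_wave_tail_zero:
  fixes k :: nat
  assumes "n \<ge> 1" "t = DCT1 \<longrightarrow> n \<ge> 2"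
  defines "\<theta> \<equiv> dtt_angle t n k"
  shows "dtt_wave t (real n) \<theta> + dtt_tail_coeff t * dtt_wave t (real n - dtt_tail_shift t) \<theta> = 0"
proof -
  define a where "a = dtt_period t n * \<theta>"
  have "dtt_period t n > 0"
    using assms(1,2) by (cases t) (auto simp: dtt_period_def)
  then have a: "a = (real k + dtt_shift t) * pi"
    by (simp add: a_def \<theta>_def dtt_angle_def)
  have cos0: "cos a = 0" if "dtt_shift t = 1/2"
    by (simp add: a that distrib_right cos_add)
  have sin0: "sin a = 0" if "dtt_shift t \<noteq> 1/2"
    using that by (auto simp: a dtt_shift_def distrib_right sin_add split: if_splits)
  define c where "c = n - dtt_period t n"
  have n: "n * \<theta> = a + c * \<theta>" by (simp add: a_def c_def algebra_simps)
  show ?thesis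
    using cos0 sin0
    by (cases t) (simp_all add: dtt_wave_def dtt_tail_coeff_def dtt_tail_shift_def dtt_shift_def
        dtt_period_def c_def ring_distribs n cos_add cos_diff sin_add sin_diff)
qed

text \<open>The combination of waves that vanishes at this angle is f(\<theta>) p(cos \<theta>), and
  f(\<theta>) is nonzero.\<close>

lemma poly_dtt_poly_zero:
  assumes "n \<ge> 1" "t = DCT1 \<longrightarrow> n \<ge> 2" "k < n"
  shows "poly (dtt_poly t (int n)) (of_real (cos (dtt_angle t n k))) = 0"
proof -
  let ?\<theta> = "dtt_angle t n k"
  have "int n - dtt_tail_shift t \<ge> -1" using assms(1) by (simp add: dtt_tail_shift_def)
  then have "of_real (dtt_scale t ?\<theta>) * poly (dtt_poly t (int n)) (of_real (cos ?\<theta>)) =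
    complex_of_real (dtt_wave t n ?\<theta> + dtt_tail_coeff t * dtt_wave t (real n - dtt_tail_shift t) ?\<theta>)"
    using dtt_wave_eq_cheb[of "int n" t ?\<theta>] dtt_wave_eq_cheb[of "int n - dtt_tail_shift t" t ?\<theta>]
    by (simp add: dtt_poly_eq_tail distrib_left mult.left_commute)
  then show ?thesis
    using dtt_wave_tail_zero[OF assms(1,2), of k] dtt_angle_bounds(3)[OF assms] by simp
qed

lemma decreasing_zeros_eqI:
  assumes "sorted_wrt (>) xs" "set xs = {x. poly p (of_real x) = 0}"
  shows "decreasing_zeros p = xs"
proof -
  have "sorted_wrt (<) (rev xs)" using assms(1) by (simp add: sorted_wrt_rev)
  then have "sorted_list_of_set (set (rev xs)) = rev xs"
    by (intro sorted_list_of_set.idem_if_sorted_distinct) (simp_all add: strict_sorted_iff)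
  then show ?thesis unfolding decreasing_zeros_def assms(2)[symmetric] by simp
qed

section \<open>The Chinese remainder isomorphism and its matrices\<close>

abbreviation CX :: "complex poly ring" where "CX \<equiv> ring_of_type_algebra"

lemma CX_simps [simp]:
  "carrier CX = UNIV" "x \<otimes>\<^bsub>CX\<^esub> y = x * y" "x \<oplus>\<^bsub>CX\<^esub> y = x + y" "\<one>\<^bsub>CX\<^esub> = 1" "\<zero>\<^bsub>CX\<^esub> = 0"
  by (simp_all add: ring_of_type_algebra_def)

interpretation CX: cring CX
  by (rule cring_from_type_algebra)

lemma CX_a_inv [simp]: "\<ominus>\<^bsub>CX\<^esub> x = - x"
  by (rule CX.minus_equality) auto

lemma CX_minus [simp]: "x \<ominus>\<^bsub>CX\<^esub> y = x - y"
  by (simp add: a_minus_def)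

lemma PIdl_CX: "PIdl\<^bsub>CX\<^esub> p = {s. p dvd s}"
  by (auto simp: cgenideal_def dvd_def mult.commute)

lemma PIdl_CX_ideal: "ideal (PIdl\<^bsub>CX\<^esub> p) CX"
  by (rule CX.cgenideal_ideal) simp

lemma residue_eq_iff: "residue p s = residue p s' \<longleftrightarrow> p dvd s - s'"
  using CX.quotient_eq_iff_same_a_r_cos[OF PIdl_CX_ideal, of s s' p]
  by (simp add: residue_def PIdl_CX)

lemma residue_ring_hom_ring: "ring_hom_ring CX (poly_quot p) (residue p)"
  using ideal.rcos_ring_hom_ring[OF PIdl_CX_ideal, of p]
  unfolding poly_quot_def residue_def[abs_def] .

lemma carrier_poly_quot: "carrier (poly_quot p) = range (residue p)"
  by (auto simp: poly_quot_def residue_def FactRing_def A_RCOSETS_def')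

text \<open>Factor theorem: a residue modulo x - z carries just the value at z.\<close>

lemma residue_linear_eq_iff: "residue [:-z, 1:] s = residue [:-z, 1:] s' \<longleftrightarrow> poly s z = poly s' z"
  by (simp add: residue_eq_iff poly_eq_0_iff_dvd[symmetric])

text \<open>The list product is an iterated binary product. The diagonal, followed by the product of
  the head map and the tail map, lands in a binary product, and consing carries that to the list
  product.\<close>

lemma RDirProd_list_ring_hom:
  assumes "\<And>z. z \<in> set zs \<Longrightarrow> h z \<in> Ring.ring_hom R (S z)"
  shows "(\<lambda>s. map (\<lambda>z. h z s) zs) \<in> Ring.ring_hom R (RDirProd_list (map S zs))"
  using assms
proof (induction zs)
  case Nil
  then show ?case by (auto simp: Ring.ring_hom_def monoid.defs)
next
  case (Cons z zs)
  have "(\<lambda>a. (h z a, map (\<lambda>z. h z a) zs)) \<in> Ring.ring_hom R (RDirProd (S z) (RDirProd_list (map S zs)))"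
    using ring_hom_trans[OF RDirProd_hom1
        RDirProd_hom3[OF Cons.prems Cons.IH[OF Cons.prems]], of z]
    by (simp add: comp_def)
  from ring_hom_trans[OF this RDirProd_list_hom1] show ?case
    by (simp add: comp_def)
qed

text \<open>The homomorphism that induces the Chinese remainder isomorphism once its kernel is
  identified as the ideal of p.\<close>

definition residues :: "complex list \<Rightarrow> complex poly \<Rightarrow> complex poly set list" where
  "residues zs s = map (\<lambda>z. residue [:-z, 1:] s) zs"

lemma residues_eq_iff: "residues zs s = residues zs s' \<longleftrightarrow> (\<forall>z\<in>set zs. poly s z = poly s' z)"
  by (simp add: residues_def residue_linear_eq_iff)

lemma residues_ring_hom_ring: "ring_hom_ring CX (sum_quot zs) (residues zs)"
proof -
  have "ring (sum_quot zs)"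
    unfolding sum_quot_def
    using residue_ring_hom_ring[THEN ring_hom_ring.axioms(2)]
    by (intro RDirProd_list_is_ring) simp
  moreover have "residues zs \<in> Ring.ring_hom CX (sum_quot zs)"
    unfolding sum_quot_def residues_def[abs_def]
    by (rule RDirProd_list_ring_hom) (rule ring_hom_ring.homh[OF residue_ring_hom_ring])
  ultimately show ?thesis
    using CX.ring_axioms by (simp add: ring_hom_ring_def ring_hom_ring_axioms_def)
qed

text \<open>Newton's scheme: a multiple of \<open>m\<close>, which vanishes at the old points only,
  corrects the value at the new point.\<close>

lemma interpolation:
  fixes v :: "nat \<Rightarrow> complex"
  assumes "distinct zs"
  shows "\<exists>q. \<forall>j<length zs. poly q (zs ! j) = v j"
  using assms
proof (induction zs rule: rev_induct)
  case (snoc z zs)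
  then obtain q where q: "\<forall>j<length zs. poly q (zs ! j) = v j" by auto
  define m where "m = (\<Prod>a\<leftarrow>zs. [:-a, 1:])"
  have m: "poly m a = 0 \<longleftrightarrow> a \<in> set zs" for a
    unfolding m_def by (induction zs) auto
  define q' where "q' = q + smult ((v (length zs) - poly q z) / poly m z) m"
  have "poly m z \<noteq> 0" using m snoc.prems by simp
  then have "poly q' z = v (length zs)" by (simp add: q'_def)
  moreover have "poly q' (zs ! j) = v j" if "j < length zs" for j
    using that q m[of "zs ! j"] by (simp add: q'_def)
  ultimately show ?case
    by (intro exI[of _ q']) (auto simp: nth_append less_Suc_eq)
qed simp

text \<open>The surjectivity in the Chinese remainder theorem: a coordinate is determined by the
  value of a representative at its point, and interpolation realizes all these values by one
  polynomial.\<close>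

lemma carrier_sum_quot:
  assumes "distinct zs"
  shows "carrier (sum_quot zs) = range (residues zs)"
proof (rule subset_antisym)
  show "range (residues zs) \<subseteq> carrier (sum_quot zs)"
    using ring_hom_ring.homh[OF residues_ring_hom_ring, of zs] by (auto simp: Ring.ring_hom_def)
next
  show "carrier (sum_quot zs) \<subseteq> range (residues zs)"
  proof (rule subsetI)
    fix Y assume "Y \<in> carrier (sum_quot zs)"
    then have len: "length Y = length zs"
      and "\<forall>i<length zs. Y ! i \<in> range (residue [:-(zs ! i), 1:])"
      using RDirProd_list_carrier_mem[of Y "map (\<lambda>z. poly_quot [:-z, 1:]) zs"]
      by (auto simp: sum_quot_def carrier_poly_quot)
    then obtain s where s: "\<forall>i<length zs. Y ! i = residue [:-(zs ! i), 1:] (s i)"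
      unfolding image_iff by metis
    obtain q where "\<forall>i<length zs. poly q (zs ! i) = poly (s i) (zs ! i)"
      using interpolation[OF assms, of "\<lambda>i. poly (s i) (zs ! i)"] by blast
    then have "Y = residues zs q"
      using len s by (intro nth_equalityI) (auto simp: residues_def residue_linear_eq_iff)
    then show "Y \<in> range (residues zs)" by blast
  qed
qed

section \<open>Linear combinations and bases, computed in C[x]\<close>

definition lincomb :: "complex list \<Rightarrow> complex poly list \<Rightarrow> complex poly" where
  "lincomb cs us = (\<Sum>i<length us. smult (cs ! i) (us ! i))"

lemma combine_CX:
  "length cs = length us \<Longrightarrow> CX.combine (map (\<lambda>c. [:c:]) cs) us = lincomb cs us"
  by (induction cs us rule: list_induct2)
    (simp_all add: lincomb_def sum.lessThan_Suc_shift del: sum.lessThan_Suc)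

lemma combine_ring_hom:
  assumes "ring_hom_ring CX S h" "length cs = length us"
  shows "ring.combine S (map (\<lambda>c. h [:c:]) cs) (map h us) = h (lincomb cs us)"
proof -
  interpret h: ring_hom_ring CX S h by fact
  show ?thesis
    using h.combine_hom[of "map (\<lambda>c. [:c:]) cs" us] assms(2) by (simp add: combine_CX comp_def)
qed

text \<open>The scalars are the image of the field of complex numbers under its embedding into C[x]
  followed by \<open>h\<close>; as 1 and 0 differ in \<open>S\<close>, this image is a
  field.\<close>

lemma subfield_constants:
  assumes "ring_hom_ring CX S h" "\<one>\<^bsub>S\<^esub> \<noteq> \<zero>\<^bsub>S\<^esub>"
  shows "subfield (range (\<lambda>c. h [:c:])) S"
proof -
  interpret h: ring_hom_ring CX S h by fact
  let ?C = "ring_of_type_algebra :: complex ring"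
  interpret C: field ?C by (rule field_from_type_algebra)
  have "(\<lambda>c. [:c:]) \<in> Ring.ring_hom ?C CX"
    by (auto simp: Ring.ring_hom_def ring_of_type_algebra_def)
  from ring_hom_trans[OF this h.homh]
  interpret g: ring_hom_ring ?C S "\<lambda>c. h [:c:]"
    by unfold_locales (simp add: comp_def)
  show ?thesis
    using g.img_is_subfield(2)[OF C.carrier_is_subfield assms(2)]
    by (simp add: ring_of_type_algebra_def)
qed

text \<open>Lets the basis proofs below argue with polynomial sums \<open>lincomb cs us\<close>
  instead of \<open>combine\<close> over the subfield of constants.\<close>

lemma is_basis_ring_hom:
  assumes h: "ring_hom_ring CX S h" and one: "\<one>\<^bsub>S\<^esub> \<noteq> \<zero>\<^bsub>S\<^esub>"
    and indep: "\<And>cs. length cs = length us \<Longrightarrow> h (lincomb cs us) = h 0 \<Longrightarrow> \<forall>c\<in>set cs. c = 0"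
    and span: "\<And>y. y \<in> carrier S \<Longrightarrow> \<exists>cs. length cs = length us \<and> y = h (lincomb cs us)"
  shows "is_basis S (\<lambda>c. h [:c:]) (map h us)"
proof -
  interpret h: ring_hom_ring CX S h by fact
  let ?K = "range (\<lambda>c. h [:c:])"
  note K = subfield_constants[OF h one]
  have carr: "set (map h us) \<subseteq> carrier S" by auto
  have h0: "h 0 = \<zero>\<^bsub>S\<^esub>" using h.hom_zero by simp
  have "h.S.independent ?K (map h us)"
  proof (rule ccontr)
    assume dep: "\<not> ?thesis"
    then obtain Ks where Ks: "length Ks = length (map h us)" "h.S.combine Ks (map h us) = \<zero>\<^bsub>S\<^esub>"
      "set Ks \<subseteq> ?K" "set Ks \<noteq> {\<zero>\<^bsub>S\<^esub>}"
      by (rule h.S.dependent_imp_non_trivial_combine[OF K carr])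
    have "\<exists>cs. Ks = map (\<lambda>c. h [:c:]) cs" unfolding ex_map_conv using Ks(3) by auto
    then obtain cs where cs: "Ks = map (\<lambda>c. h [:c:]) cs" ..
    have "\<forall>c\<in>set cs. c = 0"
      using Ks cs by (intro indep) (simp_all add: h0 combine_ring_hom[OF h])
    then have "set Ks \<subseteq> {\<zero>\<^bsub>S\<^esub>}" by (auto simp: cs h0)
    \<comment> \<open>The nontriviality \<open>set Ks \<noteq> {0}\<close> also admits the empty
      list, but then \<open>us\<close> is empty and hence independent.\<close>
    then have "Ks = []" using Ks(4) by (metis set_empty2 subset_singletonD)
    then have "us = []" using Ks(1) by simp
    then show False using dep by simp
  qed
  moreover have "h.S.Span ?K (map h us) = carrier S"
  proof
    show "h.S.Span ?K (map h us) \<subseteq> carrier S"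
      by (rule h.S.Span_in_carrier) auto
    show "carrier S \<subseteq> h.S.Span ?K (map h us)"
    proof
      fix y assume "y \<in> carrier S"
      then obtain cs where "length cs = length us" "y = h (lincomb cs us)" using span by blast
      then show "y \<in> h.S.Span ?K (map h us)"
        unfolding h.S.Span_eq_combine_set[OF K carr]
        by (auto simp flip: combine_ring_hom[OF h] intro!: exI[of _ "map (\<lambda>c. h [:c:]) cs"])
    qed
  qed
  ultimately show ?thesis by (simp add: is_basis_def)
qed

text \<open>The coefficient of the highest power sees only the last summand, so its scalar is 0;
  induction treats the rest.\<close>

lemma graded_independent:
  fixes u :: "nat \<Rightarrow> complex poly"
  assumes "\<And>i. i < n \<Longrightarrow> degree (u i) = i" "\<And>i. i < n \<Longrightarrow> u i \<noteq> 0"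
    and "(\<Sum>i<n. smult (c i) (u i)) = 0" "i < n"
  shows "c i = 0"
  using assms
proof (induction n)
  case (Suc n)
  have "coeff (\<Sum>i<n. smult (c i) (u i)) n = 0"
    using Suc.prems(1) by (simp add: coeff_sum coeff_eq_0)
  with Suc.prems(3) have "c n * lead_coeff (u n) = 0"
    using Suc.prems(1)[of n] by (metis add_0 coeff_0 coeff_add coeff_smult lessI sum.lessThan_Suc)
  then have "c n = 0" using Suc.prems(2)[of n] by simp
  with Suc show ?case by (cases "i = n") simp_all
qed simp

text \<open>Subtracting a multiple of the last \<open>u\<close> kills the top coefficient. Bounding
  \<open>s\<close> by its coefficients, not by \<open>degree s < n\<close>, lets the induction start
  at n = 0 with s = 0.\<close>

lemma graded_span:
  fixes u :: "nat \<Rightarrow> complex poly"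
  assumes "\<And>i. i < n \<Longrightarrow> degree (u i) = i" "\<And>i. i < n \<Longrightarrow> u i \<noteq> 0"
    and "\<And>i. i \<ge> n \<Longrightarrow> coeff s i = 0"
  shows "\<exists>c. s = (\<Sum>i<n. smult (c i) (u i))"
  using assms
proof (induction n arbitrary: s)
  case 0
  then show ?case by (auto intro: poly_eqI)
next
  case (Suc n)
  define a where "a = coeff s n / lead_coeff (u n)"
  have "coeff (s - smult a (u n)) i = 0" if "i \<ge> n" for i
  proof (cases "i = n")
    case True
    moreover have "coeff (u n) n \<noteq> 0"
      using Suc.prems(1,2)[of n] by (metis leading_coeff_neq_0 lessI)
    ultimately show ?thesis using Suc.prems(1)[of n] by (simp add: a_def)
  next
    case False
    then show ?thesis using that Suc.prems(1)[of n] Suc.prems(3)[of i] by (simp add: coeff_eq_0)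
  qed
  with Suc obtain c where "s - smult a (u n) = (\<Sum>i<n. smult (c i) (u i))"
    by (metis less_Suc_eq)
  then have "s = (\<Sum>i<Suc n. smult ((c(n := a)) i) (u i))" by (simp add: algebra_simps)
  then show ?case by blast
qed

lemma poly_quot_one_neq_zero:
  assumes "degree p > 0"
  shows "\<one>\<^bsub>poly_quot p\<^esub> \<noteq> \<zero>\<^bsub>poly_quot p\<^esub>"
proof -
  interpret h: ring_hom_ring CX "poly_quot p" "residue p" by (rule residue_ring_hom_ring)
  have "\<not> p dvd 1" using assms dvd_imp_degree_le[of p 1] by auto
  then show ?thesis
    using residue_eq_iff[of p 1 0] h.hom_one h.hom_zero by simp
qed

text \<open>A combination of the \<open>bs\<close> has degree below that of p, so p divides it only
  if it is 0. Conversely, each class contains the remainder modulo p, which the \<open>bs\<close>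
  span.\<close>

lemma is_basis_graded:
  assumes "length bs = degree p" "degree p > 0"
    and "\<And>i. i < degree p \<Longrightarrow> degree (bs ! i) = i" "\<And>i. i < degree p \<Longrightarrow> bs ! i \<noteq> 0"
  shows "is_basis (poly_quot p) (const_residue p) (map (residue p) bs)"
proof (rule is_basis_ring_hom[OF residue_ring_hom_ring poly_quot_one_neq_zero[OF assms(2)]])
  fix cs assume cs: "length cs = length bs" "residue p (lincomb cs bs) = residue p 0"
  then have "p dvd lincomb cs bs" by (simp add: residue_eq_iff)
  moreover have "degree (lincomb cs bs) < degree p"
    unfolding lincomb_def using assms
    by (intro degree_sum_less) (auto intro: le_less_trans[OF degree_smult_le])
  ultimately have "lincomb cs bs = 0" by (metis dvd_imp_degree_le not_le)
  then show "\<forall>c\<in>set cs. c = 0"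
    using graded_independent[of "degree p" "(!) bs" "(!) cs"] assms cs(1)
    by (auto simp: lincomb_def in_set_conv_nth)
next
  fix y assume "y \<in> carrier (poly_quot p)"
  then obtain s where s: "y = residue p s" by (auto simp: carrier_poly_quot)
  have "coeff (s mod p) i = 0" if "i \<ge> degree p" for i
    using degree_mod_less[of p s] that assms(2) by (cases "p = 0") (auto intro!: coeff_eq_0)
  then obtain c where "s mod p = (\<Sum>i<degree p. smult (c i) (bs ! i))"
    using graded_span[of "degree p" "(!) bs" "s mod p"] assms by blast
  then have "s mod p = lincomb (map c [0..<length bs]) bs"
    using assms(1) by (simp add: lincomb_def)
  moreover have "y = residue p (s mod p)"
    by (simp add: s residue_eq_iff minus_mod_eq_mult_div)
  ultimately show "\<exists>cs. length cs = length bs \<and> y = residue p (lincomb cs bs)"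
    by (intro exI[of _ "map c [0..<length bs]"]) simp
qed

lemma is_basis_linear_quot:
  assumes "a \<noteq> 0"
  shows "is_basis (poly_quot [:-z, 1:]) (const_residue [:-z, 1:]) [const_residue [:-z, 1:] a]"
  using is_basis_graded[of "[[:a:]]" "[:-z, 1:]"] assms by simp

text \<open>The members of \<open>L\<close> are scaled Lagrange polynomials: evaluating a
  combination at \<open>zs ! j\<close> isolates \<open>cs ! j * as ! j\<close>, from which the
  coefficient is recovered by division.\<close>

lemma is_basis_sum_quot:
  assumes "distinct zs" "zs \<noteq> []" "length L = length zs"
    and L: "\<And>j k. j < length zs \<Longrightarrow> k < length zs \<Longrightarrow>
      poly (L ! k) (zs ! j) = (if j = k then as ! j else 0)"
    and "\<And>j. j < length zs \<Longrightarrow> as ! j \<noteq> 0"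
  shows "is_basis (sum_quot zs) (sum_scalar zs) (map (residues zs) L)"
proof -
  interpret h: ring_hom_ring CX "sum_quot zs" "residues zs" by (rule residues_ring_hom_ring)
  have comb: "poly (lincomb cs L) (zs ! j) = cs ! j * as ! j" if "j < length zs" for cs j
    using that assms(3) L[OF that] unfolding lincomb_def poly_sum poly_smult
    by (subst sum.remove[of _ j]) (auto intro!: sum.neutral)
  have "is_basis (sum_quot zs) (\<lambda>c. residues zs [:c:]) (map (residues zs) L)"
  proof (rule is_basis_ring_hom[OF residues_ring_hom_ring])
    show "\<one>\<^bsub>sum_quot zs\<^esub> \<noteq> \<zero>\<^bsub>sum_quot zs\<^esub>"
      using residues_eq_iff[of zs 1 0] h.hom_one h.hom_zero assms(2) by simp
  next
    fix cs assume "length cs = length L" "residues zs (lincomb cs L) = residues zs 0"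
    then have "cs ! j = 0" if "j < length zs" for j
      using comb[OF that, of cs] assms(5)[OF that] that by (auto simp: residues_eq_iff)
    then show "\<forall>c\<in>set cs. c = 0"
      using \<open>length cs = length L\<close> assms(3) by (auto simp: in_set_conv_nth)
  next
    fix y assume "y \<in> carrier (sum_quot zs)"
    then obtain s where s: "y = residues zs s" by (auto simp: carrier_sum_quot[OF assms(1)])
    define cs where "cs = map (\<lambda>j. poly s (zs ! j) / as ! j) [0..<length zs]"
    have "residues zs s = residues zs (lincomb cs L)"
      using comb[of _ cs] assms(5) by (auto simp: residues_eq_iff in_set_conv_nth cs_def)
    then show "\<exists>cs. length cs = length L \<and> y = residues zs (lincomb cs L)"
      using s assms(3) by (intro exI[of _ cs]) (simp add: cs_def)
  qed
  moreover have "sum_scalar zs = (\<lambda>c. residues zs [:c:])"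
    by (auto simp: sum_scalar_def residues_def)
  ultimately show ?thesis by simp
qed

section \<open>The Chinese remainder isomorphism and its matrix\<close>

lemma dvd_iff_vanishes_at_zeros:
  fixes p :: "complex poly"
  assumes "distinct zs" "length zs = degree p" "\<forall>z\<in>set zs. poly p z = 0" "p \<noteq> 0"
  shows "p dvd s \<longleftrightarrow> (\<forall>z\<in>set zs. poly s z = 0)"
proof
  assume "p dvd s"
  then show "\<forall>z\<in>set zs. poly s z = 0" using assms(3) by auto
next
  assume s: "\<forall>z\<in>set zs. poly s z = 0"
  \<comment> \<open>The remainder vanishes at as many points as p has degree, too many for a nonzero
    polynomial of smaller degree.\<close>
  have "s mod p = 0"
  proof (rule ccontr)
    assume neq: "s mod p \<noteq> 0"
    have "poly (s mod p) z = 0" if "z \<in> set zs" for z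
      using that s assms(3) by (simp flip: minus_div_mult_eq_mod)
    then have "card (set zs) \<le> card {z. poly (s mod p) z = 0}"
      by (intro card_mono) (use neq poly_roots_finite in auto)
    also have "\<dots> \<le> degree (s mod p)" by (rule card_poly_roots_bound[OF neq])
    also have "\<dots> < degree p" using degree_mod_less'[OF assms(4) neq] .
    finally show False using assms by (simp add: distinct_card)
  qed
  then show "p dvd s" by (simp add: dvd_eq_mod_eq_0)
qed

text \<open>First isomorphism theorem for \<open>residues zs\<close>: it is onto by
  \<open>carrier_sum_quot\<close>, and its kernel, the polynomials vanishing on \<open>zs\<close>,
  is the ideal of p.\<close>

lemma crt_iso_exists:
  assumes "distinct zs" "length zs = degree p" "\<forall>z\<in>set zs. poly p z = 0" "p \<noteq> 0"
  shows "\<exists>\<phi>. is_crt_iso p zs \<phi>"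
proof -
  interpret h: ring_hom_ring CX "sum_quot zs" "residues zs" by (rule residues_ring_hom_ring)
  have h0: "\<zero>\<^bsub>sum_quot zs\<^esub> = residues zs 0" using h.hom_zero by simp
  have ker: "a_kernel CX (sum_quot zs) (residues zs) = PIdl\<^bsub>CX\<^esub> p"
    unfolding a_kernel_def' PIdl_CX h0 residues_eq_iff dvd_iff_vanishes_at_zeros[OF assms] by simp
  \<comment> \<open>A coset of the kernel has a singleton image under \<open>residues zs\<close>,
    whose element is the value of the induced map.\<close>
  define \<phi> where "\<phi> = (\<lambda>Y. the_elem (residues zs ` Y))"
  have "\<phi> \<in> ring_iso (poly_quot p) (sum_quot zs)"
    using h.FactRing_iso_set carrier_sum_quot[OF assms(1)]
    unfolding ker \<phi>_def poly_quot_def by simp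
  moreover have "\<phi> (residue p s) = residues zs s" for s
    using h.the_elem_simp[of s] unfolding ker \<phi>_def residue_def by simp
  moreover have "residues zs s = map (\<lambda>z. const_residue [:-z, 1:] (poly s z)) zs" for s
    by (simp add: residues_def residue_linear_eq_iff)
  ultimately show ?thesis unfolding is_crt_iso_def by metis
qed

text \<open>Relative to the basis a_k of the k-th summand, b_l has the coordinate b_l(z_k)/a_k; the
  entry condition on \<open>M\<close> expresses this without division.\<close>

lemma is_decomposition_matrixI:
  assumes zs: "distinct zs" "length zs = degree p" "\<forall>z\<in>set zs. poly p z = 0" and "degree p > 0"
    and bs: "length bs = degree p"
      "\<And>i. i < degree p \<Longrightarrow> degree (bs ! i) = i" "\<And>i. i < degree p \<Longrightarrow> bs ! i \<noteq> 0"
    and as: "length as = degree p" "0 \<notin> set as"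
    and M: "M \<in> carrier_mat (degree p) (degree p)"
      "\<And>k l. k < degree p \<Longrightarrow> l < degree p \<Longrightarrow> M $$ (k, l) * as ! k = poly (bs ! l) (zs ! k)"
  shows "is_decomposition_matrix p zs bs as M"
proof -
  let ?n = "degree p"
  have as_neq: "as ! j \<noteq> 0" if "j < ?n" for j using that as by (metis nth_mem)
  obtain \<phi> where \<phi>: "is_crt_iso p zs \<phi>" using crt_iso_exists[OF zs] \<open>degree p > 0\<close> by force
  have "\<exists>q. \<forall>j<length zs. poly q (zs ! j) = (if j = k then as ! j else 0)" for k
    by (rule interpolation[OF zs(1)])
  \<comment> \<open>Scaled Lagrange polynomials: \<open>q k\<close> lifts the k-th vector of
    \<open>sum_basis zs as\<close> to C[x].\<close>
  then obtain q where
    q: "\<And>k j. j < length zs \<Longrightarrow> poly (q k) (zs ! j) = (if j = k then as ! j else 0)"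
    by metis
  define L where "L = map q [0..<?n]"
  have L: "sum_basis zs as = map (residues zs) L"
    using q zs(2) by (simp add: L_def sum_basis_def residues_def residue_linear_eq_iff list_eq_iff_nth_eq)
  have "\<phi> (residue p (bs ! l)) =
      ring.combine (sum_quot zs) (map (\<lambda>k. sum_scalar zs (M $$ (k, l))) [0..<?n]) (sum_basis zs as)"
    if l: "l < ?n" for l
  proof -
    define cs where "cs = map (\<lambda>k. M $$ (k, l)) [0..<?n]"
    have "ring.combine (sum_quot zs) (map (\<lambda>k. sum_scalar zs (M $$ (k, l))) [0..<?n]) (sum_basis zs as)
      = residues zs (lincomb cs L)"
      using combine_ring_hom[OF residues_ring_hom_ring, of cs L zs]
      by (simp add: L cs_def L_def comp_def residues_def sum_scalar_def)
    \<comment> \<open>Modulo the linear factors only values at the zeros matter, and there the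
      Lagrange sum collapses to one term.\<close>
    also have "poly (lincomb cs L) (zs ! k) = poly (bs ! l) (zs ! k)" if "k < ?n" for k
    proof -
      have "poly (lincomb cs L) (zs ! k) = (\<Sum>i<?n. M $$ (i, l) * (if k = i then as ! k else 0))"
        using that q zs(2) by (simp add: lincomb_def poly_sum L_def cs_def)
      also have "\<dots> = M $$ (k, l) * as ! k"
        using that by (subst sum.remove[of _ k]) auto
      finally show ?thesis using that l M(2) by simp
    qed
    then have "residues zs (lincomb cs L) = residues zs (bs ! l)"
      using zs(2) by (auto simp: residues_eq_iff in_set_conv_nth)
    finally show ?thesis
      using \<phi> by (simp add: is_crt_iso_def residues_def residue_linear_eq_iff)
  qed
  moreover have "is_basis (poly_quot p) (const_residue p) (map (residue p) bs)"
    by (rule is_basis_graded) (use assms in auto)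
  moreover have "is_basis (sum_quot zs) (sum_scalar zs) (sum_basis zs as)"
    unfolding L
    by (rule is_basis_sum_quot[where as = as]) (use zs as_neq q \<open>degree p > 0\<close> in \<open>auto simp: L_def\<close>)
  moreover have "length (sum_basis zs as) = ?n" by (simp add: sum_basis_def zs(2))
  ultimately have "represents (poly_quot p) (const_residue p) (map (residue p) bs)
          (sum_quot zs) (sum_scalar zs) (sum_basis zs as) M \<phi>"
    using M(1) bs(1) by (simp add: represents_def)
  then show ?thesis
    unfolding is_decomposition_matrix_def
    using \<phi> as(1) zs(2) as_neq is_basis_linear_quot by auto
qed


section \<open>Zeros, scaling and decomposition for the sixteen transforms\<close>

theorem theorem12:
  fixes t :: dtt and n :: nat
  assumes "n \<ge> 1" and "t = DCT1 \<Longrightarrow> n \<ge> 2"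
  defines "p \<equiv> dtt_poly t (int n)"
  defines "\<alpha> \<equiv> decreasing_zeros p"
  defines "zs \<equiv> map complex_of_real \<alpha>"
  defines "b \<equiv> map (\<lambda>l. dtt_cheb t (int l)) [0..<n]"
  defines "f \<equiv> \<lambda>k. dtt_scale t (arccos (\<alpha> ! k))"
  shows "p = dtt_poly_alt t (int n) \<and>
    card {z. poly p z = 0} = n \<and>
    set zs = {z. poly p z = 0} \<and> length \<alpha> = n \<and> sorted_wrt (>) \<alpha> \<and> set \<alpha> \<subseteq> {-1..1} \<and>
    dtt_mat t n = mat_diag n (\<lambda>k. complex_of_real (f k)) * polynomial_transform b zs \<and>
    (\<forall>k<n. f k \<noteq> 0) \<and>
    is_fourier_transform p zs b (dtt_mat t n) \<and>
    is_decomposition_matrix p zs b (map (\<lambda>k. complex_of_real (1 / f k)) [0..<n]) (dtt_mat t n)"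
proof -
  have n: "n \<ge> 1" "t = DCT1 \<longrightarrow> n \<ge> 2" using assms(1,2) by auto
  let ?\<theta> = "dtt_angle t n"
  define xs where "xs = map (\<lambda>k. cos (?\<theta> k)) [0..<n]"
  have deg: "degree p = n" unfolding p_def by (rule degree_dtt_poly[OF n])
  then have "p \<noteq> 0" using n(1) by auto
  \<comment> \<open>The angles increase within [0, \<pi>], where cosine is strictly
    decreasing.\<close>
  have desc: "sorted_wrt (>) xs"
    using dtt_angle_less[OF n] dtt_angle_bounds[OF n]
    by (auto simp: xs_def sorted_wrt_iff_nth_less intro!: cos_monotone_0_pi)
  then have "sorted_wrt (<) (rev xs)" by (simp add: sorted_wrt_rev)
  then have "distinct xs" unfolding strict_sorted_iff by simp
  then have dist: "distinct (map complex_of_real xs)" by (simp add: distinct_map inj_on_def)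
  have "complex_of_real ` set xs \<subseteq> {z. poly p z = 0}"
    using poly_dtt_poly_zero[OF n] by (auto simp: xs_def p_def)
  moreover have "card (complex_of_real ` set xs) = n"
    using distinct_card[OF dist] by (simp add: xs_def image_image)
  \<comment> \<open>The degree is n, so these n distinct zeros are all of them; in particular every
    complex zero is real.\<close>
  ultimately have roots: "complex_of_real ` set xs = {z. poly p z = 0}"
    using card_poly_roots_bound[OF \<open>p \<noteq> 0\<close>] poly_roots_finite[OF \<open>p \<noteq> 0\<close>] deg
    by (intro card_seteq) auto
  \<comment> \<open>\<open>decreasing_zeros\<close> looks only at real zeros, so
    \<open>roots\<close> is pulled back along the embedding of the reals.\<close>
  have "set xs = complex_of_real -` complex_of_real ` set xs"
    by (simp add: inj_vimage_image_eq inj_of_real)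
  then have "set xs = {x. poly p (of_real x) = 0}" unfolding roots by simp
  then have "\<alpha> = xs" unfolding \<alpha>_def by (rule decreasing_zeros_eqI[OF desc])
  then have zs: "zs = map complex_of_real xs" by (simp add: zs_def)
  have card: "card {z. poly p z = 0} = n"
    using roots \<open>card _ = n\<close> by simp
  \<comment> \<open>\<open>arccos\<close> recovers the angle from its cosine because the angle lies
    in [0, \<pi>].\<close>
  have f: "f k = dtt_scale t (?\<theta> k)" if "k < n" for k
    using that dtt_angle_bounds[OF n that] by (simp add: f_def \<open>\<alpha> = xs\<close> xs_def arccos_cos)
  then have f_neq: "\<forall>k<n. f k \<noteq> 0" using dtt_angle_bounds(3)[OF n] by simp
  have entry: "dtt_mat t n $$ (k, l) = of_real (f k) * poly (b ! l) (zs ! k)" if "k < n" "l < n" for k l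
    using that dtt_wave_eq_cheb[of "int l" t "?\<theta> k"]
    by (simp add: dtt_mat_def dtt_entry_eq_wave f b_def zs xs_def)
  have "polynomial_transform b zs \<in> carrier_mat n n"
    by (simp add: polynomial_transform_def b_def zs xs_def)
  then have "dtt_mat t n = mat_diag n (\<lambda>k. complex_of_real (f k)) * polynomial_transform b zs"
    by (intro eq_matI)
      (simp_all add: mat_diag_mult_left entry, simp_all add: polynomial_transform_def dtt_mat_def b_def zs xs_def)
  moreover have decomp:
    "is_decomposition_matrix p zs b (map (\<lambda>k. complex_of_real (1 / f k)) [0..<n]) (dtt_mat t n)"
  proof (rule is_decomposition_matrixI)
    obtain q where q: "dtt_cheb t = cheb q" "degree q = 1" using dtt_cheb_eq by blast
    show "degree (b ! i) = i" "b ! i \<noteq> 0" if "i < degree p" for i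
      using that by (simp_all add: deg b_def q degree_cheb cheb_neq_0)
    show "\<forall>z\<in>set zs. poly p z = 0" using roots by (auto simp: zs)
    \<comment> \<open>The basis element 1/f(\<alpha>_k) cancels the scaling factor in
      \<open>entry\<close>.\<close>
    show "dtt_mat t n $$ (k, l) * map (\<lambda>k. complex_of_real (1 / f k)) [0..<n] ! k = poly (b ! l) (zs ! k)"
      if "k < degree p" "l < degree p" for k l
      using that f_neq by (simp add: deg entry)
    show "0 \<notin> set (map (\<lambda>k. complex_of_real (1 / f k)) [0..<n])" using f_neq by auto
  qed (use n(1) dist in \<open>simp_all add: deg zs xs_def b_def dtt_mat_def\<close>)
  moreover have "set zs = {z. poly p z = 0}" using roots by (simp add: zs)
  moreover have "is_fourier_transform p zs b (dtt_mat t n)"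
    unfolding is_fourier_transform_def
    using decomp f_neq dist zs \<open>set zs = _\<close>
    by (intro conjI exI[of _ "map (\<lambda>k. complex_of_real (1 / f k)) [0..<n]"]) auto
  moreover have "p = dtt_poly_alt t (int n)" unfolding p_def by (rule dtt_poly_eq_alt)
  moreover have "set \<alpha> \<subseteq> {-1..1}" "length \<alpha> = n" by (auto simp: \<open>\<alpha> = xs\<close> xs_def)
  ultimately show ?thesis using desc f_neq card \<open>\<alpha> = xs\<close> by blast
qed

end
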